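(* For every integer $n\ge2$, $$n\,\mathbb{Z}^{o}_{\ge3}=n\Bigl(\mathbb{Z}^{o}_{\ge3}\setminus\bigl(\textstyle\bigsqcup_{i=1}^{n-1}\mathcal{C}^{(i)}_{>1}\bigr)\Bigr),$$ and $\bigsqcup_{i=1}^{n-1}\mathcal{C}^{(i)}_{>1}$ is an $n$-th sum-factor collapsed subset of $\mathbb{Z}^{o}_{\ge3}$.
   Context: $\mathbb{Z}^{o}_{\ge3}$ is the set of all odd integers $\ge3$; $\mathcal{P}_{\ge3}$ is the set of all odd primes; $\mathcal{C}^{o}_{>1}$ is the set of all odd composite positive integers. For a non-empty set $S$ of integers, $nS=\{s_1+\cdots+s_n: s_i\in S\}$ (the $n$-fold sumset), and $S+T=\{s+t:s\in S,t\in T\}$. The subsets $\mathcal{C}^{(i)}_{>1}$ of $\mathcal{C}^{o}_{>1}$ (pairwise disjoint) are defined inductively by $\mathcal{C}^{(1)}_{>1}=\{c\in\mathcal{C}^{o}_{>1}: 3+c\in2\mathcal{P}_{\ge3}\}$ and, for $k\ge2$, $\mathcal{C}^{(k)}_{>1}=\{c\in\mathcal{C}^{o}_{>1}\setminus\bigcup_{i=1}^{k-1}\mathcal{C}^{(i)}_{>1}: 3+c\in\mathcal{P}_{\ge3}+\mathcal{C}^{(k-1)}_{>1}\}$ (with the sumset empty if $\mathcal{C}^{(k-1)}_{>1}=\emptyset$). A subset $C\subset B$ (with $B$ a non-empty set of integers) is an $n$-th sum-factor collapsed subset of $B$ if $B\setminus C$ is non-empty, $nB=n(B\setminus C)$,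 and every $b\in B$ is a product $c_1\cdots c_k$ with $k\ge1$ and all $c_j\in B\setminus C$. *)

theory Defs
  imports
    "HOL-Computational_Algebra.Primes"
    "HOL-Library.Set_Algebras"
    "HOL-Library.Disjoint_Sets"
begin

definition odd_ge3 :: "int set"
  where "odd_ge3 = {z. odd z \<and> z \<ge> 3}"

definition odd_primes :: "int set"
  where "odd_primes = {p. odd p \<and> prime p}"

definition odd_composites :: "int set"
  where "odd_composites = {c. odd c \<and> c > 1 \<and> \<not> prime c}"

text \<open>The \<open>n\<close>-fold sumset \<open>nS\<close>; it is not the dilate \<open>{n * s | s. s \<in> S}\<close>.
  The binary sumset \<open>S + T\<close> is the one of Set Algebras, which is empty
  as soon as \<open>S\<close> or \<open>T\<close> is.\<close>

definition nfold_sumset :: "nat \<Rightarrow> int set \<Rightarrow> int set"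
  where "nfold_sumset n S = {\<Sum>i<n. s i | s. \<forall>i<n. s i \<in> S}"

text \<open>The classes are indexed from 1; index 0 is a dummy value.\<close>

function composite_class :: "nat \<Rightarrow> int set" where
  "composite_class 0 = {}"
| "composite_class (Suc 0) = {c \<in> odd_composites. 3 + c \<in> nfold_sumset 2 odd_primes}"
| "composite_class (Suc (Suc k)) =
    {c \<in> odd_composites - (\<Union>i\<in>{1..Suc k}. composite_class i).
       3 + c \<in> odd_primes + composite_class (Suc k)}"
  by pat_completeness auto
termination by (relation "measure id") auto

lemma disjoint_composite_class: "disjoint_family_on composite_class {1..}"
proof -
  have *: "composite_class i \<inter> composite_class j = {}" if "1 \<le> i" "i < j" for i j
  proof -
    from that obtain k where "j = Suc (Suc k)"
      by (metis One_nat_def Suc_le_D less_eq_Suc_le not_less_eq_eq not0_implies_Suc not_less_zero)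
    with that show ?thesis by auto
  qed
  show ?thesis
    unfolding disjoint_family_on_def
    by (metis * Int_commute atLeast_iff linorder_neqE_nat)
qed

definition sum_factor_collapsed :: "nat \<Rightarrow> int set \<Rightarrow> int set \<Rightarrow> bool"
  where "sum_factor_collapsed n B C \<longleftrightarrow>
    B \<noteq> {} \<and> C \<subseteq> B \<and> B - C \<noteq> {} \<and>
    nfold_sumset n B = nfold_sumset n (B - C) \<and>
    (\<forall>b\<in>B. \<exists>cs. cs \<noteq> [] \<and> set cs \<subseteq> B - C \<and> b = prod_list cs)"

end

(* Every element of n odd_ge3 has the form c + 3 (n - 1) with c odd, c \<ge> 3. If c lies in the
   k-th class, k < n, then unfolding the recursion trades k of the summands 3 together with c
   for k + 1 odd primes; primes never lie in any of the classes. *)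

theory Submission
  imports Defs
begin

lemma nfold_sumset_mono: "S \<subseteq> T \<Longrightarrow> nfold_sumset n S \<subseteq> nfold_sumset n T"
  unfolding nfold_sumset_def by blast

lemma nfold_sumset_0 [simp]: "nfold_sumset 0 S = {0}"
  by (simp add: nfold_sumset_def)

lemma nfold_sumset_Suc: "nfold_sumset (Suc n) S = S + nfold_sumset n S"
proof (intro equalityI subsetI)
  fix x assume "x \<in> nfold_sumset (Suc n) S"
  then obtain s where s: "\<forall>i<Suc n. s i \<in> S" and x: "x = (\<Sum>i<Suc n. s i)"
    unfolding nfold_sumset_def by blast
  from s have "(\<Sum>i<n. s i) \<in> nfold_sumset n S" "s n \<in> S"
    unfolding nfold_sumset_def by auto
  then show "x \<in> S + nfold_sumset n S"
    unfolding x by (auto simp: add.commute)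
next
  fix x assume "x \<in> S + nfold_sumset n S"
  then obtain a s where "a \<in> S" and s: "\<forall>i<n. s i \<in> S" and x: "x = a + (\<Sum>i<n. s i)"
    unfolding nfold_sumset_def by (auto elim!: set_plus_elim)
  \<comment> \<open>The extra summand \<open>a\<close> takes the last index \<open>n\<close>, so the
    first \<open>n\<close> summands stay as they are.\<close>
  define t where "t = s(n := a)"
  have "\<forall>i<Suc n. t i \<in> S" "x = (\<Sum>i<Suc n. t i)"
    using s \<open>a \<in> S\<close> by (auto simp: t_def x)
  then show "x \<in> nfold_sumset (Suc n) S"
    unfolding nfold_sumset_def by blast
qed

text \<open>Padding: a sum with too few summands is brought up to the required number by repeating
  one fixed element, which below is always 3.\<close>

lemma nfold_sumset_add_multiple:
  assumes "a \<in> S" "x \<in> nfold_sumset m S"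
  shows "int k * a + x \<in> nfold_sumset (k + m) S"
proof (induction k)
  case (Suc k)
  then have "a + (int k * a + x) \<in> nfold_sumset (Suc (k + m)) S"
    unfolding nfold_sumset_Suc using assms(1) by (rule set_plus_intro[rotated])
  then show ?case
    by (simp add: algebra_simps)
qed (use assms in simp)

text \<open>The excess of each summand over 3 is even and nonnegative, so it can be shifted onto a
  single summand, which remains odd and at least 3.\<close>

lemma nfold_sumset_odd_ge3E:
  assumes "x \<in> nfold_sumset (Suc n) odd_ge3"
  obtains c where "c \<in> odd_ge3" "x = 3 * int n + c"
proof -
  have "x - 3 * int n \<in> odd_ge3"
    using assms
  proof (induction n arbitrary: x)
    case 0
    then show ?case by (auto simp: nfold_sumset_Suc elim!: set_plus_elim)
  next
    case (Suc n)
    then obtain a y where "a \<in> odd_ge3" "y \<in> nfold_sumset (Suc n) odd_ge3" "x = a + y"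
      by (subst (asm) nfold_sumset_Suc) (auto elim: set_plus_elim)
    with Suc.IH[of y] show ?case by (auto simp: odd_ge3_def)
  qed
  with that show ?thesis by force
qed

lemma composite_class_subset: "composite_class k \<subseteq> odd_composites"
  by (cases k rule: composite_class.cases) auto

lemma composite_class_plus_threes:
  "c \<in> composite_class (Suc k) \<Longrightarrow> 3 * int (Suc k) + c \<in> nfold_sumset (Suc (Suc k)) odd_primes"
proof (induction k arbitrary: c)
  case 0
  then show ?case by (simp add: numeral_2_eq_2)
next
  case (Suc k)
  then obtain p c' where p: "p \<in> odd_primes" and c': "c' \<in> composite_class (Suc k)"
    and eq: "3 + c = p + c'"
    by (auto elim: set_plus_elim)
  \<comment> \<open>One 3 is spent on turning \<open>c\<close> into \<open>p + c'\<close>; the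
    induction hypothesis absorbs the other \<open>Suc k\<close> threes together with
    \<open>c'\<close>.\<close>
  from eq have "3 * int (Suc (Suc k)) + c = p + (3 * int (Suc k) + c')"
    by simp
  with set_plus_intro[OF p Suc.IH[OF c']] show ?case
    by (simp only: nfold_sumset_Suc[of "Suc (Suc k)"])
qed

text \<open>The classes contain only composites, so removing any family of them keeps every odd
  prime. Both the sums and the factorizations below rely on this.\<close>

lemma odd_primes_subset:
  "odd_primes \<subseteq> odd_ge3 - (\<Union>i\<in>I. composite_class i)"
proof -
  have "p \<ge> 3" if "prime p" "odd p" for p :: int
    using prime_ge_2_int[OF that(1)] that(2) by (cases "p = 2") auto
  moreover have "odd_primes \<inter> odd_composites = {}"
    by (auto simp: odd_primes_def odd_composites_def)
  ultimately show ?thesis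
    using composite_class_subset unfolding odd_primes_def odd_ge3_def by blast
qed

lemma nfold_sumset_odd_ge3_minus_classes:
  "nfold_sumset (Suc n) odd_ge3 =
     nfold_sumset (Suc n) (odd_ge3 - (\<Union>i\<in>{1..n}. composite_class i))"
    (is "_ = nfold_sumset _ ?A")
proof (intro equalityI subsetI)
  fix x assume "x \<in> nfold_sumset (Suc n) odd_ge3"
  then obtain c where c: "c \<in> odd_ge3" and x: "x = 3 * int n + c"
    by (rule nfold_sumset_odd_ge3E)
  have "3 \<in> odd_primes"
    by (simp add: odd_primes_def)
  then have 3: "3 \<in> ?A"
    using odd_primes_subset by blast
  show "x \<in> nfold_sumset (Suc n) ?A"
  proof (cases "c \<in> ?A")
    case True
    then have "c \<in> nfold_sumset 1 ?A"
      by (auto simp: nfold_sumset_Suc)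
    from nfold_sumset_add_multiple[OF 3 this, of n] show ?thesis
      by (simp add: x mult.commute)
  next
    case False
    with c obtain k where "Suc k \<le> n" "c \<in> composite_class (Suc k)"
      by (metis DiffI UN_E atLeastAtMost_iff One_nat_def Suc_le_D)
    then have "3 * int (Suc k) + c \<in> nfold_sumset (Suc (Suc k)) ?A"
      using composite_class_plus_threes nfold_sumset_mono[OF odd_primes_subset] by blast
    \<comment> \<open>The \<open>k + 2\<close> odd primes use up \<open>c\<close> and
      \<open>k + 1\<close> threes; the \<open>n - Suc k\<close> threes left over complete the count
      to \<open>n + 1\<close>.\<close>
    from nfold_sumset_add_multiple[OF 3 this, of "n - Suc k"] \<open>Suc k \<le> n\<close> show ?thesis
      by (simp add: x algebra_simps)
  qed
qed (use nfold_sumset_mono[of ?A odd_ge3] in blast)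

lemma odd_ge3_prod_list_odd_primes:
  assumes "b \<in> odd_ge3"
  shows "\<exists>cs. cs \<noteq> [] \<and> set cs \<subseteq> odd_primes \<and> b = prod_list cs"
proof -
  obtain cs where cs: "mset cs = prime_factorization b"
    using ex_mset by blast
  have b: "odd b" "b \<ge> 3"
    using assms by (auto simp: odd_ge3_def)
  \<comment> \<open>For integers the prime factorization recovers \<open>b\<close> only up to sign;
    here \<open>b\<close> is positive.\<close>
  then have prod: "b = prod_list cs"
    by (simp add: prod_mset_prod_list[symmetric] cs prod_mset_prime_factorization)
  have "odd p \<and> prime p" if "p \<in> set cs" for p
  proof -
    have "p \<in># prime_factorization b"
      using that cs by (metis set_mset_mset)
    then show ?thesis
      using b(1) by (meson dvd_trans in_prime_factors_iff)
  qed
  \<comment> \<open>The empty product is 1, which \<open>b \<ge> 3\<close> excludes.\<close>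
  moreover have "cs \<noteq> []"
    using prod b by auto
  ultimately show ?thesis
    using prod by (auto simp: odd_primes_def)
qed

theorem theorem3p15:
  fixes n :: nat
  assumes "n \<ge> 2"
  shows "nfold_sumset n odd_ge3 =
           nfold_sumset n (odd_ge3 - (\<Union>i\<in>{1..n - 1}. composite_class i)) \<and>
         sum_factor_collapsed n odd_ge3 (\<Union>i\<in>{1..n - 1}. composite_class i)"
proof -
  let ?C = "\<Union>i\<in>{1..n - 1}. composite_class i"
  have eq: "nfold_sumset n odd_ge3 = nfold_sumset n (odd_ge3 - ?C)"
    using nfold_sumset_odd_ge3_minus_classes[of "n - 1"] assms by simp
  have "c \<ge> 3" if "odd c" "c > 1" for c :: int
    using that by presburger
  then have "odd_composites \<subseteq> odd_ge3"
    by (auto simp: odd_composites_def odd_ge3_def)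
  then have "?C \<subseteq> odd_ge3"
    using composite_class_subset by blast
  moreover have "3 \<in> odd_primes"
    by (simp add: odd_primes_def)
  \<comment> \<open>3 witnesses that \<open>odd_ge3\<close> is non-empty and stays so once the
    classes are removed.\<close>
  then have "3 \<in> odd_ge3 - ?C"
    using odd_primes_subset by blast
  \<comment> \<open>Factoring into primes suffices, since all odd primes survive the
    removal.\<close>
  moreover have "\<forall>b\<in>odd_ge3. \<exists>cs. cs \<noteq> [] \<and> set cs \<subseteq> odd_ge3 - ?C \<and> b = prod_list cs"
    using odd_ge3_prod_list_odd_primes odd_primes_subset by (meson subset_trans)
  ultimately show ?thesis
    using eq unfolding sum_factor_collapsed_def by blast
qed

end
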